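(* Let $f:\mathbb{R}^d\to\mathbb{R}$ be a differentiable function with unique minimizer $x^\star$ which is convex, $L$-smooth for some $L>0$, and satisfies the $\alpha$-quadratic growth condition $f(x)\ge f(x^\star)+\frac{\alpha}{2}\|x-x^\star\|^2$ for all $x\in\mathbb{R}^d$, for some $\alpha>0$. Let $c>0$, $0<\eta\le\frac{1}{\sqrt{L}}$, $K\ge1$ an integer, $x_0\in\mathbb{R}^d$, and let $N$ be an integer with $N\ge\left\lceil\frac{c}{\eta\sqrt{\alpha}}\right\rceil$. Let $x_K$ be the output of the algorithm dHFA-eg run from $x_0$ for $K$ iterations with parameter $\lambda=0$, step size $\eta$, and discretization steps $N_k=N$ for all $k\in\{1,\dots,K\}$. Then $$f(x_K)-f(x^\star)\le\left(\frac{2}{3}+\frac{2}{3c^2}\right)^K(f(x_0)-f(x^\star)).$$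
   Context: $f$ is $L$-smooth if $f(x')\le f(x)+\langle\nabla f(x),x'-x\rangle+\frac{L}{2}\|x'-x\|^2$ for all $x,x'\in\mathbb{R}^d$. The extragradient integrator with step size $\eta>0$ started at $(x_0,y_0)\in\mathbb{R}^{2d}$ generates, for $n\ge0$, $x_{n+1/2}=x_n+\eta y_n$, $x_{n+1}=x_{n+1/2}-\eta^2\nabla f(x_{n+1/2})$, $y_{n+1}=y_n-\eta\nabla f(x_{n+1})$. Algorithm dHFA-eg. Input: $x_0\in\mathbb{R}^d$, number of iterations $K\in\mathbb{N}$, parameter $\lambda\ge0$, step size $\eta>0$, discretization steps $N_1,\dots,N_K\in\mathbb{N}$ (positive integers). For $k=1,\dots,K$: generate $(x^{(k)}_n,y^{(k)}_n)_{n=1}^{N_k}$ with the extragradient integrator with step size $\eta$ started at $(x^{(k)}_0,y^{(k)}_0)=(x_{k-1},\mathbf{0})$; compute $x^{\mathrm{avg}}(x_{k-1};N_k)=\frac{2}{N_k(N_k+1)}\sum_{n=1}^{N_k}(N_k-n+1)x^{(k)}_n$; set $x_k=\frac{1}{\lambda+1}x^{\mathrm{avg}}(x_{k-1};N_k)+\frac{\lambda}{\lambda+1}x^{(k)}_{N_k}$. Output: $x_K$. *)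

theory Defs
  imports "HOL-Analysis.Analysis"
begin

text \<open>The gradient; meaningful at points where \<open>f\<close> is differentiable (see \<open>GDERIV_grad\<close>).\<close>

definition grad :: "('a::euclidean_space \<Rightarrow> real) \<Rightarrow> 'a \<Rightarrow> 'a" where
  "grad f x = (THE D. GDERIV f x :> D)"

lemma GDERIV_grad:
  fixes f :: "'a::euclidean_space \<Rightarrow> real"
  assumes "f differentiable (at x)"
  shows "GDERIV f x :> grad f x"
proof -
  obtain f' where f': "(f has_derivative f') (at x)"
    using assms by (auto simp: differentiable_def)
  then interpret linear f'
    by (rule has_derivative_linear)
  have "f' h = h \<bullet> adjoint f' 1" for h
    using adjoint_works[OF linear_axioms, of h "1::real"] by simp
  then have "f' = (\<lambda>h. h \<bullet> adjoint f' 1)"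
    by (rule ext)
  with f' have ex: "GDERIV f x :> adjoint f' 1"
    by (simp add: gderiv_def)
  moreover have "D = E" if "GDERIV f x :> D" "GDERIV f x :> E" for D E
  proof -
    have "(\<lambda>h. h \<bullet> D) = (\<lambda>h. h \<bullet> E)"
      using that unfolding gderiv_def by (rule has_derivative_unique)
    then have "h \<bullet> (D - E) = 0" for h
      by (simp add: inner_diff_right fun_eq_iff)
    then have "(D - E) \<bullet> (D - E) = 0"
      by blast
    then show ?thesis
      by simp
  qed
  ultimately have "\<exists>!D. GDERIV f x :> D"
    by blast
  then show ?thesis
    unfolding grad_def by (rule theI')
qed

definition L_smooth :: "real \<Rightarrow> ('a::euclidean_space \<Rightarrow> real) \<Rightarrow> bool" where
  "L_smooth L f \<longleftrightarrow>
     (\<forall>x x'. f x' \<le> f x + grad f x \<bullet> (x' - x) + L / 2 * (norm (x' - x))\<^sup>2)"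

definition unique_minimizer :: "('a \<Rightarrow> real) \<Rightarrow> 'a \<Rightarrow> bool" where
  "unique_minimizer f x \<longleftrightarrow> (\<forall>z. is_arg_min f (\<lambda>_. True) z \<longleftrightarrow> z = x)"

definition quadratic_growth :: "real \<Rightarrow> ('a::euclidean_space \<Rightarrow> real) \<Rightarrow> 'a \<Rightarrow> bool" where
  "quadratic_growth \<alpha> f xs \<longleftrightarrow> (\<forall>x. f x \<ge> f xs + \<alpha> / 2 * (norm (x - xs))\<^sup>2)"

text \<open>One step of the extragradient integrator. The momentum is updated with the gradient at
  the new position, not at the half step.\<close>

definition eg_step :: "('a::euclidean_space \<Rightarrow> real) \<Rightarrow> real \<Rightarrow> 'a \<times> 'a \<Rightarrow> 'a \<times> 'a" where
  "eg_step f \<eta> = (\<lambda>(x, y).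
     let xhalf = x + \<eta> *\<^sub>R y;
         x' = xhalf - \<eta>\<^sup>2 *\<^sub>R grad f xhalf;
         y' = y - \<eta> *\<^sub>R grad f x'
     in (x', y'))"

primrec eg_iterate ::
  "('a::euclidean_space \<Rightarrow> real) \<Rightarrow> real \<Rightarrow> 'a \<times> 'a \<Rightarrow> nat \<Rightarrow> 'a \<times> 'a" where
  "eg_iterate f \<eta> s0 0 = s0"
| "eg_iterate f \<eta> s0 (Suc n) = eg_step f \<eta> (eg_iterate f \<eta> s0 n)"

definition eg_pos :: "('a::euclidean_space \<Rightarrow> real) \<Rightarrow> real \<Rightarrow> 'a \<Rightarrow> nat \<Rightarrow> 'a" where
  "eg_pos f \<eta> x0 n = fst (eg_iterate f \<eta> (x0, 0) n)"

definition x_avg :: "('a::euclidean_space \<Rightarrow> real) \<Rightarrow> real \<Rightarrow> 'a \<Rightarrow> nat \<Rightarrow> 'a" where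
  "x_avg f \<eta> x0 N =
     (2 / (real N * (real N + 1))) *\<^sub>R
       (\<Sum>n=1..N. (real N - real n + 1) *\<^sub>R eg_pos f \<eta> x0 n)"

text \<open>The outer iterations are numbered from 1, so \<open>N 0\<close> is never used.\<close>

primrec dHFA_eg ::
  "('a::euclidean_space \<Rightarrow> real) \<Rightarrow> real \<Rightarrow> real \<Rightarrow> (nat \<Rightarrow> nat) \<Rightarrow> 'a \<Rightarrow> nat \<Rightarrow> 'a" where
  "dHFA_eg f lam \<eta> N x0 0 = x0"
| "dHFA_eg f lam \<eta> N x0 (Suc k) =
     (let x = dHFA_eg f lam \<eta> N x0 k
      in (1 / (lam + 1)) *\<^sub>R x_avg f \<eta> x (N (Suc k))
         + (lam / (lam + 1)) *\<^sub>R eg_pos f \<eta> x (N (Suc k)))"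

end

theory Submission
  imports Defs
begin

text \<open>
  The extragradient integrator discretizes the Hamiltonian flow \<open>x' = y\<close>, \<open>y' = - \<nabla>f(x)\<close> started
  at rest. Along that flow the energy \<open>f(x) + |y|\<^sup>2/2\<close> is conserved, so with
  \<open>\<Delta> = f(x\<^sub>0) - f(x\<^sup>\<star>)\<close> convexity gives
  \<open>d/dt \<langle>x - x\<^sup>\<star>, y\<rangle> = |y|\<^sup>2 - \<langle>x - x\<^sup>\<star>, \<nabla>f(x)\<rangle> \<le> 2\<Delta> - 3 (f(x) - f(x\<^sup>\<star>))\<close>.
  Since \<open>\<langle>x - x\<^sup>\<star>, y\<rangle>\<close> is itself the derivative of \<open>|x - x\<^sup>\<star>|\<^sup>2/2\<close>, integrating twice bounds the
  average of \<open>f(x) - f(x\<^sup>\<star>)\<close> with weight \<open>T - t\<close> by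
  \<open>2/3 \<Delta> + |x\<^sub>0 - x\<^sup>\<star>|\<^sup>2 / (3 T\<^sup>2)\<close>. Quadratic growth turns the last term into a multiple of \<open>\<Delta>\<close>
  (for \<open>T \<ge> c / \<surd>\<alpha>\<close>, at most \<open>2/(3 c\<^sup>2) \<Delta>\<close>), and Jensen's inequality moves the average inside
  \<open>f\<close>. Restarting from the averaged point with zero momentum repeats the contraction, once for
  each outer iteration.

  For the discrete dynamics, with \<open>T = N \<eta>\<close>, the same argument gives the same bound when \<open>L \<eta>\<^sup>2 \<le> 1\<close>.
  The energy decreases (\<open>eg_energy_decreases\<close>) because the gradient changes by at most its own
  length over the corrector step. The errors made by replacing \<open>x' = y\<close> by a difference quotient
  either telescope (\<open>eg_power_bound\<close>) or are absorbed by the curvature term of smooth convex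
  functions (\<open>eg_position_gain\<close>). The two summations are \<open>momentum_bound\<close> and
  \<open>weighted_gap_sum_bound\<close>.\<close>

section \<open>Smooth convex functions\<close>

lemma convex_above_tangent_plane:
  fixes f :: "'a::euclidean_space \<Rightarrow> real"
  assumes "convex_on UNIV f" and "f differentiable (at x)"
  shows "f x + grad f x \<bullet> (z - x) \<le> f z"
proof -
  define \<phi> where "\<phi> t = f (x + t *\<^sub>R (z - x))" for t :: real
  have "convex_on UNIV \<phi>"
  proof (rule convex_onI)
    fix t u v :: real
    assume t: "0 < t" "t < 1"
    have "x + ((1 - t) * u + t * v) *\<^sub>R (z - x)
        = (1 - t) *\<^sub>R (x + u *\<^sub>R (z - x)) + t *\<^sub>R (x + v *\<^sub>R (z - x))"
      by (simp add: algebra_simps)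
    with t convex_onD[OF assms(1), of t]
    show "\<phi> ((1 - t) *\<^sub>R u + t *\<^sub>R v) \<le> (1 - t) * \<phi> u + t * \<phi> v"
      by (simp add: \<phi>_def)
  qed simp
  moreover have "(\<phi> has_real_derivative grad f x \<bullet> (z - x)) (at 0)"
  proof -
    have "((\<lambda>t. x + t *\<^sub>R (z - x)) has_derivative (\<lambda>t. t *\<^sub>R (z - x))) (at (0::real))"
      by (auto intro!: derivative_eq_intros)
    moreover have "(f has_derivative (\<lambda>h. h \<bullet> grad f x)) (at (x + (0::real) *\<^sub>R (z - x)))"
      using GDERIV_grad[OF assms(2)] by (simp add: gderiv_def)
    ultimately have "((\<lambda>t. f (x + t *\<^sub>R (z - x))) has_derivative
        (\<lambda>t. (t *\<^sub>R (z - x)) \<bullet> grad f x)) (at (0::real))"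
      by (rule has_derivative_compose)
    then show ?thesis
      by (simp add: \<phi>_def[abs_def] has_field_derivative_def inner_commute
          mult_commute_abs)
  qed
  ultimately have "grad f x \<bullet> (z - x) * (1 - 0) \<le> \<phi> 1 - \<phi> 0"
    by (intro convex_on_imp_above_tangent[where A = UNIV]) auto
  then show ?thesis
    by (simp add: \<phi>_def)
qed

locale smooth_convex =
  fixes f :: "'a::euclidean_space \<Rightarrow> real" and L :: real
  assumes differentiable: "f differentiable (at x)"
    and convex: "convex_on UNIV f"
    and L_pos: "L > 0"
    and smooth: "L_smooth L f"
begin

lemma tangent_plane: "f x + grad f x \<bullet> (z - x) \<le> f z"
  by (rule convex_above_tangent_plane[OF convex differentiable])

lemma smooth_upper: "f z \<le> f x + grad f x \<bullet> (z - x) + L / 2 * (norm (z - x))\<^sup>2"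
  using smooth by (simp add: L_smooth_def)

text \<open>The tangent plane at \<open>x\<close> and the quadratic upper bound at \<open>z\<close> are compared at the point
  reached from \<open>z\<close> by a gradient step of length \<open>1/L\<close> for \<open>f\<close> minus its linearization at \<open>x\<close>.\<close>

lemma tangent_plane_curvature:
  "f x + grad f x \<bullet> (z - x) + (norm (grad f z - grad f x))\<^sup>2 / (2 * L) \<le> f z"
proof -
  define d where "d = grad f z - grad f x"
  define w where "w = z - (1 / L) *\<^sub>R d"
  have "f x + grad f x \<bullet> (w - x) \<le> f z + grad f z \<bullet> (w - z) + L / 2 * (norm (w - z))\<^sup>2"
    using tangent_plane[of x w] smooth_upper[of w z] by linarith
  moreover have "L / 2 * (norm (w - z))\<^sup>2 = (norm d)\<^sup>2 / (2 * L)"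
    using L_pos by (simp add: w_def power_divide power2_eq_square)
  moreover have "grad f x \<bullet> (w - x) = grad f x \<bullet> (z - x) - (grad f x \<bullet> d) / L"
    and "grad f z \<bullet> (w - z) = - (grad f z \<bullet> d) / L"
    by (simp_all add: w_def inner_diff_right)
  moreover have "(grad f z \<bullet> d) / L - (grad f x \<bullet> d) / L = (norm d)\<^sup>2 / L"
    by (simp add: d_def power2_norm_eq_inner inner_diff_left diff_divide_distrib)
  moreover have "(norm d)\<^sup>2 / L = 2 * ((norm d)\<^sup>2 / (2 * L))"
    by simp
  ultimately show ?thesis
    unfolding d_def by linarith
qed

lemma grad_cocoercive:
  "(norm (grad f z - grad f x))\<^sup>2 \<le> L * ((grad f z - grad f x) \<bullet> (z - x))"
proof -
  have "(norm (grad f z - grad f x))\<^sup>2 / L \<le> (grad f z - grad f x) \<bullet> (z - x)"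
    using tangent_plane_curvature[of x z] tangent_plane_curvature[of z x]
    by (simp add: norm_minus_commute inner_diff_left inner_diff_right)
  then show ?thesis
    using L_pos by (simp add: field_simps)
qed

lemma grad_minimizer_zero:
  assumes "\<And>z. f xs \<le> f z"
  shows "grad f xs = 0"
proof -
  define g where "g = grad f xs"
  have "f xs \<le> f (xs - (1 / L) *\<^sub>R g)"
    by (rule assms)
  also have "\<dots> \<le> f xs - (norm g)\<^sup>2 / (2 * L)"
    using smooth_upper[of "xs - (1 / L) *\<^sub>R g" xs] L_pos
    by (simp add: g_def power_divide power2_norm_eq_inner[symmetric] power2_eq_square[of L] field_simps)
  finally have "(norm g)\<^sup>2 \<le> 0"
    using L_pos by (simp add: field_simps)
  then show ?thesis
    by (simp add: g_def)
qed

end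

section \<open>Sums with triangular weights\<close>

lemma triangular_weights_Suc:
  fixes g :: "nat \<Rightarrow> real"
  shows "(\<Sum>n=1..Suc N. (real (Suc N) - real n + 1) * g n)
    = (\<Sum>n=1..N. (real N - real n + 1) * g n) + (\<Sum>n=1..Suc N. g n)"
proof -
  have "(\<Sum>n=1..Suc N. (real (Suc N) - real n + 1) * g n)
      = (\<Sum>n=1..Suc N. (real N - real n + 1) * g n + g n)"
    by (intro sum.cong) (simp_all add: algebra_simps)
  also have "\<dots> = (\<Sum>n=1..Suc N. (real N - real n + 1) * g n) + (\<Sum>n=1..Suc N. g n)"
    by (rule sum.distrib)
  finally show ?thesis
    by simp
qed

lemma triangular_weights_sum: "(\<Sum>n=1..N. real N - real n + 1) = real N * (real N + 1) / 2"
proof (induction N)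
  case (Suc N)
  with triangular_weights_Suc[of N "\<lambda>_. 1"] show ?case
    by (simp add: field_simps)
qed simp

section \<open>One step of the integrator\<close>

locale eg_method = smooth_convex f L
  for f :: "'a::euclidean_space \<Rightarrow> real" and L :: real +
  fixes \<eta> :: real and xs :: 'a
  assumes step_pos: "\<eta> > 0"
    and step_le: "L * \<eta>\<^sup>2 \<le> 1"
    and minimizer: "\<And>z. f xs \<le> f z"
begin

lemma gradient_step_decrease:
  "f (x - \<eta>\<^sup>2 *\<^sub>R grad f x) \<le> f x - \<eta>\<^sup>2 / 2 * (norm (grad f x))\<^sup>2"
proof -
  define g where "g = grad f x"
  have "f (x - \<eta>\<^sup>2 *\<^sub>R g) \<le> f x - \<eta>\<^sup>2 * (norm g)\<^sup>2 + L / 2 * (\<eta>\<^sup>2 * norm g)\<^sup>2"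
    using smooth_upper[of "x - \<eta>\<^sup>2 *\<^sub>R g" x] by (simp add: g_def power2_norm_eq_inner)
  also have "L / 2 * (\<eta>\<^sup>2 * norm g)\<^sup>2 = (L * \<eta>\<^sup>2) * (\<eta>\<^sup>2 / 2 * (norm g)\<^sup>2)"
    by (simp add: power_mult_distrib power2_eq_square)
  also have "\<dots> \<le> 1 * (\<eta>\<^sup>2 / 2 * (norm g)\<^sup>2)"
    using step_le by (intro mult_right_mono) auto
  finally show ?thesis
    by (simp add: g_def)
qed

text \<open>By cocoercivity and the Cauchy-Schwarz inequality, the gradient is Lipschitz with constant
  \<open>L\<close>; the step has length \<open>\<eta>\<^sup>2 |grad f x|\<close> with \<open>\<eta>\<^sup>2 \<le> 1/L\<close>.\<close>

lemma gradient_step_grad_change: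
  "norm (grad f (x - \<eta>\<^sup>2 *\<^sub>R grad f x) - grad f x) \<le> norm (grad f x)"
proof -
  define g where "g = grad f x"
  define d where "d = grad f (x - \<eta>\<^sup>2 *\<^sub>R g) - g"
  have "(norm d)\<^sup>2 \<le> (L * \<eta>\<^sup>2) * (- (d \<bullet> g))"
    using grad_cocoercive[of "x - \<eta>\<^sup>2 *\<^sub>R g" x] by (simp add: g_def d_def algebra_simps)
  also have "\<dots> \<le> (L * \<eta>\<^sup>2) * (norm d * norm g)"
    using L_pos norm_cauchy_schwarz[of "- d" g] by (intro mult_left_mono) auto
  also have "\<dots> \<le> 1 * (norm d * norm g)"
    using step_le by (intro mult_right_mono) auto
  finally have "norm d * norm d \<le> norm d * norm g"
    by (simp add: power2_eq_square)
  then show ?thesis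
    by (cases "norm d = 0") (auto simp: d_def g_def)
qed

context
  fixes x y h x' :: 'a
  assumes h: "h = x + \<eta> *\<^sub>R y"
    and x': "x' = h - \<eta>\<^sup>2 *\<^sub>R grad f h"
begin

text \<open>The tangent plane at the new position bounds the change of potential energy so that the
  terms linear in \<open>y\<close> cancel. What is left is \<open>\<eta>\<^sup>2/2\<close> times
  \<open>|grad f x' - grad f h|\<^sup>2 - |grad f h|\<^sup>2\<close>.\<close>

lemma eg_energy_decreases:
  assumes y': "y' = y - \<eta> *\<^sub>R grad f x'"
  shows "f x' + (norm y')\<^sup>2 / 2 \<le> f x + (norm y)\<^sup>2 / 2"
proof -
  let ?g = "grad f h" and ?g' = "grad f x'"
  have "f x' - f x \<le> ?g' \<bullet> (x' - x)"
    using tangent_plane[of x' x] by (simp add: inner_diff_right)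
  also have "\<dots> = \<eta> * (?g' \<bullet> y) - \<eta>\<^sup>2 * (?g' \<bullet> ?g)"
    by (simp add: x' h inner_diff_right inner_add_right)
  finally have "f x' - f x \<le> \<eta> * (?g' \<bullet> y) - \<eta>\<^sup>2 * (?g' \<bullet> ?g)" .
  moreover have "(norm y')\<^sup>2 = (norm y)\<^sup>2 - 2 * (\<eta> * (?g' \<bullet> y)) + \<eta>\<^sup>2 * (norm ?g')\<^sup>2"
    unfolding power2_norm_eq_inner
    by (simp add: y' inner_diff_left inner_diff_right inner_commute power2_eq_square
        algebra_simps)
  moreover have "\<eta>\<^sup>2 * (norm (?g' - ?g))\<^sup>2 \<le> \<eta>\<^sup>2 * (norm ?g)\<^sup>2"
    using gradient_step_grad_change[of h] by (intro mult_left_mono power_mono) (auto simp: x')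
  moreover have "\<eta>\<^sup>2 * (norm (?g' - ?g))\<^sup>2
      = \<eta>\<^sup>2 * (norm ?g')\<^sup>2 - 2 * (\<eta>\<^sup>2 * (?g' \<bullet> ?g)) + \<eta>\<^sup>2 * (norm ?g)\<^sup>2"
    by (simp add: power2_norm_eq_inner inner_diff_left inner_diff_right inner_commute
        algebra_simps)
  ultimately show ?thesis
    by linarith
qed

text \<open>In the flow, \<open>\<langle>dx/dt, y\<rangle> = |y|\<^sup>2\<close>. The corrector step perturbs this by
  \<open>- \<eta> \<langle>grad f h, \<eta> y\<rangle>\<close>, and convexity along the segment from \<open>x\<close> to \<open>h\<close> bounds the
  perturbation by a difference of function values, which telescopes over the steps.\<close>

lemma eg_power_bound: "\<eta> * ((x' - x) \<bullet> y) \<le> \<eta>\<^sup>2 * ((norm y)\<^sup>2 + (f x - f x'))"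
proof -
  have "f x' \<le> f h - \<eta>\<^sup>2 / 2 * (norm (grad f h))\<^sup>2"
    using gradient_step_decrease[of h] by (simp add: x')
  also have "\<dots> \<le> f h"
    by simp
  finally have "f x' \<le> f h" .
  moreover have "f h - f x \<le> \<eta> * (grad f h \<bullet> y)"
    using tangent_plane[of h x] by (simp add: h)
  ultimately have "(norm y)\<^sup>2 - \<eta> * (grad f h \<bullet> y) \<le> (norm y)\<^sup>2 + (f x - f x')"
    by linarith
  then have "\<eta>\<^sup>2 * ((norm y)\<^sup>2 - \<eta> * (grad f h \<bullet> y)) \<le> \<eta>\<^sup>2 * ((norm y)\<^sup>2 + (f x - f x'))"
    by (intro mult_left_mono) auto
  moreover have "\<eta> * ((x' - x) \<bullet> y) = \<eta>\<^sup>2 * ((norm y)\<^sup>2 - \<eta> * (grad f h \<bullet> y))"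
    unfolding power2_norm_eq_inner
    by (simp add: x' inner_diff_left inner_add_left power2_eq_square algebra_simps)
       (simp add: h inner_add_left algebra_simps)
  ultimately show ?thesis
    by simp
qed

text \<open>The curvature term \<open>|grad f h|\<^sup>2 / (2 L)\<close> together with the decrease of \<open>f\<close> from \<open>h\<close> to
  \<open>x'\<close> pays for evaluating the inner product at \<open>x'\<close> instead of \<open>h\<close>.\<close>

lemma eg_position_gain: "f x' - f xs \<le> (x' - xs) \<bullet> grad f h"
proof -
  let ?g = "grad f h"
  have "f h + ?g \<bullet> (xs - h) + (norm ?g)\<^sup>2 / (2 * L) \<le> f xs"
    using tangent_plane_curvature[of h xs] grad_minimizer_zero[OF minimizer] by simp
  moreover have "\<eta>\<^sup>2 / 2 * (norm ?g)\<^sup>2 \<le> (norm ?g)\<^sup>2 / (2 * L)"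
  proof -
    have "\<eta>\<^sup>2 \<le> 1 / L"
      using step_le L_pos by (simp add: field_simps)
    from mult_right_mono[OF this, of "(norm ?g)\<^sup>2 / 2"] show ?thesis
      by simp
  qed
  moreover have "f x' \<le> f h - \<eta>\<^sup>2 / 2 * (norm ?g)\<^sup>2"
    using gradient_step_decrease[of h] by (simp add: x')
  moreover have "(x' - xs) \<bullet> ?g = - (?g \<bullet> (xs - h)) - \<eta>\<^sup>2 * (norm ?g)\<^sup>2"
    by (simp add: x' power2_norm_eq_inner inner_diff_left inner_diff_right inner_commute)
  ultimately show ?thesis
    by linarith
qed

text \<open>Discrete counterpart of \<open>\<langle>x - x\<^sup>\<star>, y\<rangle>\<close> being the derivative of \<open>|x - x\<^sup>\<star>|\<^sup>2/2\<close>. Pairing the new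
  position with the old momentum makes the quadratic remainder \<open>|x' - x|\<^sup>2/2\<close> have the
  favourable sign.\<close>

lemma eg_squared_distance_growth:
  "((norm (x' - xs))\<^sup>2 - (norm (x - xs))\<^sup>2) / 2 + \<eta>\<^sup>2 * (f x' - f xs) \<le> \<eta> * ((x' - xs) \<bullet> y)"
proof -
  have "\<eta> *\<^sub>R y = (x' - x) + \<eta>\<^sup>2 *\<^sub>R grad f h"
    by (simp add: x' h)
  then have "\<eta> * ((x' - xs) \<bullet> y) = (x' - xs) \<bullet> (x' - x) + \<eta>\<^sup>2 * ((x' - xs) \<bullet> grad f h)"
    by (metis inner_add_right inner_scaleR_right)
  moreover have "(x' - xs) \<bullet> (x' - x)
      = ((norm (x' - xs))\<^sup>2 - (norm (x - xs))\<^sup>2 + (norm (x' - x))\<^sup>2) / 2"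
    by (simp add: power2_norm_eq_inner inner_diff_left inner_diff_right inner_commute)
  moreover have "\<eta>\<^sup>2 * (f x' - f xs) \<le> \<eta>\<^sup>2 * ((x' - xs) \<bullet> grad f h)"
    using eg_position_gain by (intro mult_left_mono) auto
  moreover have "0 \<le> (norm (x' - x))\<^sup>2"
    by simp
  ultimately show ?thesis
    by argo
qed

end

section \<open>Summation along a trajectory started at rest\<close>

context
  fixes x0 :: 'a
begin

abbreviation X :: "nat \<Rightarrow> 'a" where "X \<equiv> eg_pos f \<eta> x0"

definition Y :: "nat \<Rightarrow> 'a" where "Y n = snd (eg_iterate f \<eta> (x0, 0) n)"

definition gap :: "nat \<Rightarrow> real" where "gap n = f (X n) - f xs"

lemma X_0: "X 0 = x0" and Y_0: "Y 0 = 0"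
  by (simp_all add: eg_pos_def Y_def)

lemma X_Suc: "X (Suc n) = (X n + \<eta> *\<^sub>R Y n) - \<eta>\<^sup>2 *\<^sub>R grad f (X n + \<eta> *\<^sub>R Y n)"
  and Y_Suc: "Y (Suc n) = Y n - \<eta> *\<^sub>R grad f (X (Suc n))"
  by (simp_all add: eg_pos_def Y_def eg_step_def Let_def split_beta)

lemma energy_le: "gap n + (norm (Y n))\<^sup>2 / 2 \<le> gap 0"
proof (induction n)
  case 0
  then show ?case by (simp add: Y_0)
next
  case (Suc n)
  with eg_energy_decreases[OF refl X_Suc Y_Suc, of n] show ?case
    by (simp add: gap_def)
qed

lemma gap_le: "gap n \<le> gap 0"
  using energy_le[of n] by (smt (verit) divide_nonneg_nonneg zero_le_power2)

text \<open>Energy decrease bounds \<open>|y|\<^sup>2\<close> by \<open>2 (gap 0 - gap n)\<close>, which contributes two of the three gaps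
  in the bound for the flow; the third comes from convexity in \<open>momentum_bound\<close>.\<close>

lemma momentum_step:
  "\<eta> * ((X (Suc n) - xs) \<bullet> Y n)
     \<le> \<eta> * ((X n - xs) \<bullet> Y n) + \<eta>\<^sup>2 * (2 * gap 0 - gap n - gap (Suc n))"
proof -
  have "\<eta> * ((X (Suc n) - X n) \<bullet> Y n) \<le> \<eta>\<^sup>2 * ((norm (Y n))\<^sup>2 + (f (X n) - f (X (Suc n))))"
    by (rule eg_power_bound[OF refl X_Suc])
  also have "\<dots> \<le> \<eta>\<^sup>2 * (2 * gap 0 - gap n - gap (Suc n))"
    using energy_le[of n] by (intro mult_left_mono) (simp_all add: gap_def)
  finally show ?thesis
    by (simp add: inner_diff_left algebra_simps)
qed

text \<open>The first integration of the flow inequality. The boundary terms of the telescoping sum leave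
  \<open>gap m - gap 0 \<le> 0\<close>. Dropping it would spoil the next lemma, because the gaps themselves are
  not known to decrease from step to step: only their comparison with \<open>gap 0\<close> is available.\<close>

lemma momentum_bound:
  "\<eta> * ((X m - xs) \<bullet> Y m)
     \<le> \<eta>\<^sup>2 * ((2 * real m - 1) * gap 0 + gap m - 3 * (\<Sum>n=1..m. gap n))"
proof (induction m)
  case 0
  then show ?case by (simp add: Y_0)
next
  case (Suc m)
  let ?x = "X (Suc m)"
  have "gap (Suc m) \<le> (?x - xs) \<bullet> grad f ?x"
    using tangent_plane[of ?x xs] by (simp add: gap_def inner_diff_left inner_diff_right inner_commute)
  then have "\<eta>\<^sup>2 * gap (Suc m) \<le> \<eta>\<^sup>2 * ((?x - xs) \<bullet> grad f ?x)"
    by (intro mult_left_mono) auto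
  moreover have "\<eta> * ((?x - xs) \<bullet> Y (Suc m))
      = \<eta> * ((?x - xs) \<bullet> Y m) - \<eta>\<^sup>2 * ((?x - xs) \<bullet> grad f ?x)"
    by (simp add: Y_Suc inner_diff_right power2_eq_square algebra_simps)
  ultimately have "\<eta> * ((?x - xs) \<bullet> Y (Suc m))
      \<le> \<eta>\<^sup>2 * ((2 * real m - 1) * gap 0 + gap m - 3 * (\<Sum>n=1..m. gap n))
        + \<eta>\<^sup>2 * (2 * gap 0 - gap m - gap (Suc m)) - \<eta>\<^sup>2 * gap (Suc m)"
    using Suc.IH momentum_step[of m] by linarith
  then show ?case
    by (simp add: algebra_simps)
qed

lemma gap_sum_bound:
  "((norm (X (Suc m) - xs))\<^sup>2 - (norm (X m - xs))\<^sup>2) / 2 + \<eta>\<^sup>2 * (3 * (\<Sum>n=1..Suc m. gap n))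
     \<le> \<eta>\<^sup>2 * (2 * real (Suc m) * gap 0)"
proof -
  have "((norm (X (Suc m) - xs))\<^sup>2 - (norm (X m - xs))\<^sup>2) / 2 + \<eta>\<^sup>2 * gap (Suc m)
      \<le> \<eta> * ((X (Suc m) - xs) \<bullet> Y m)"
    using eg_squared_distance_growth[OF refl X_Suc] by (simp add: gap_def)
  moreover have "\<eta>\<^sup>2 * gap (Suc m) \<le> \<eta>\<^sup>2 * gap 0"
    using gap_le by (intro mult_left_mono) auto
  ultimately show ?thesis
    using momentum_bound[of m] momentum_step[of m] by (simp add: algebra_simps)
qed

text \<open>The weight \<open>N - n + 1\<close> counts the \<open>m \<in> {n..N}\<close>, so the weighted sum is the sum over \<open>m\<close> of
  the partial sums in \<open>gap_sum_bound\<close>, whose squared distances telescope.\<close>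

lemma weighted_gap_sum_bound:
  "3 * \<eta>\<^sup>2 * (\<Sum>n=1..N. (real N - real n + 1) * gap n) + (norm (X N - xs))\<^sup>2 / 2
     \<le> \<eta>\<^sup>2 * (real N * (real N + 1) * gap 0) + (norm (x0 - xs))\<^sup>2 / 2"
proof (induction N)
  case 0
  then show ?case by (simp add: X_0)
next
  case (Suc N)
  have "3 * \<eta>\<^sup>2 * (\<Sum>n=1..Suc N. (real (Suc N) - real n + 1) * gap n)
      = 3 * \<eta>\<^sup>2 * (\<Sum>n=1..N. (real N - real n + 1) * gap n)
        + \<eta>\<^sup>2 * (3 * (\<Sum>n=1..Suc N. gap n))"
    unfolding triangular_weights_Suc by (simp only: distrib_left mult_ac)
  moreover have "\<eta>\<^sup>2 * (real (Suc N) * (real (Suc N) + 1) * gap 0)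
      = \<eta>\<^sup>2 * (real N * (real N + 1) * gap 0) + \<eta>\<^sup>2 * (2 * real (Suc N) * gap 0)"
    by (simp add: algebra_simps)
  ultimately show ?case
    using Suc.IH gap_sum_bound[of N] by argo
qed

lemma x_avg_jensen:
  assumes "N \<ge> 1"
  shows "f (x_avg f \<eta> x0 N) - f xs
    \<le> 2 / (real N * (real N + 1)) * (\<Sum>n=1..N. (real N - real n + 1) * gap n)"
proof -
  define w where "w n = 2 / (real N * (real N + 1)) * (real N - real n + 1)" for n
  have sum_w: "(\<Sum>n=1..N. w n) = 1"
    using assms unfolding w_def sum_distrib_left[symmetric] triangular_weights_sum by simp
  have "f (\<Sum>n=1..N. w n *\<^sub>R X n) \<le> (\<Sum>n=1..N. w n * f (X n))"
    using assms by (intro convex_on_sum[OF _ _ convex sum_w]) (auto simp: w_def)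
  also have "\<dots> = (\<Sum>n=1..N. w n * gap n) + f xs"
    using sum_w by (simp add: gap_def right_diff_distrib sum_subtractf sum_distrib_right[symmetric])
  finally show ?thesis
    unfolding x_avg_def w_def scaleR_sum_right sum_distrib_left scaleR_scaleR mult.assoc by simp
qed

lemma x_avg_gap:
  assumes "N \<ge> 1"
  shows "f (x_avg f \<eta> x0 N) - f xs
    \<le> 2 / 3 * (f x0 - f xs) + (norm (x0 - xs))\<^sup>2 / (3 * \<eta>\<^sup>2 * (real N * (real N + 1)))"
proof -
  define W where "W = (\<Sum>n=1..N. (real N - real n + 1) * gap n)"
  define M where "M = real N * (real N + 1)"
  have pos: "M > 0" "\<eta>\<^sup>2 > 0"
    using assms step_pos by (auto simp: M_def)
  have "3 * \<eta>\<^sup>2 * W \<le> \<eta>\<^sup>2 * (M * gap 0) + (norm (x0 - xs))\<^sup>2 / 2"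
    using weighted_gap_sum_bound[of N] zero_le_power2[of "norm (X N - xs)"]
    unfolding W_def M_def by linarith
  then have "2 / M * W \<le> 2 / 3 * gap 0 + (norm (x0 - xs))\<^sup>2 / (3 * \<eta>\<^sup>2 * M)"
    using pos by (simp add: field_simps)
  with x_avg_jensen[OF assms] show ?thesis
    by (simp add: W_def M_def gap_def X_0)
qed

end

section \<open>Contraction under quadratic growth\<close>

lemma x_avg_contraction:
  assumes "\<alpha> > 0" "quadratic_growth \<alpha> f xs" "c > 0" "c \<le> \<eta> * sqrt \<alpha> * real N"
  shows "f (x_avg f \<eta> x0 N) - f xs \<le> (2 / 3 + 2 / (3 * c\<^sup>2)) * (f x0 - f xs)"
proof -
  define \<Delta> where "\<Delta> = f x0 - f xs"
  have \<Delta>: "0 \<le> \<Delta>"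
    using minimizer by (simp add: \<Delta>_def)
  have "N \<ge> 1"
    using assms(3,4) by (cases N) auto
  have "c\<^sup>2 \<le> (\<eta> * sqrt \<alpha> * real N)\<^sup>2"
    using assms by (intro power_mono) auto
  also have "\<dots> = \<alpha> * \<eta>\<^sup>2 * (real N)\<^sup>2"
    using assms(1) by (simp add: power_mult_distrib)
  also have "\<dots> \<le> \<alpha> * \<eta>\<^sup>2 * (real N * (real N + 1))"
    using assms(1) by (intro mult_left_mono) (auto simp: power2_eq_square algebra_simps)
  finally have c: "c\<^sup>2 \<le> \<alpha> * \<eta>\<^sup>2 * (real N * (real N + 1))" .
  have "(norm (x0 - xs))\<^sup>2 \<le> 2 * \<Delta> / \<alpha>"
    using assms(1,2) by (simp add: quadratic_growth_def \<Delta>_def field_simps)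
  then have "(norm (x0 - xs))\<^sup>2 / (3 * \<eta>\<^sup>2 * (real N * (real N + 1)))
      \<le> 2 * \<Delta> / \<alpha> / (3 * \<eta>\<^sup>2 * (real N * (real N + 1)))"
    by (intro divide_right_mono) auto
  also have "\<dots> = 2 * \<Delta> / (3 * (\<alpha> * \<eta>\<^sup>2 * (real N * (real N + 1))))"
    by simp
  also have "\<dots> \<le> 2 * \<Delta> / (3 * c\<^sup>2)"
    using c assms(3) \<Delta> by (intro divide_left_mono mult_pos_pos) (use assms(1) step_pos \<open>N \<ge> 1\<close> in auto)
  finally show ?thesis
    using x_avg_gap[OF \<open>N \<ge> 1\<close>, of x0] by (simp add: \<Delta>_def algebra_simps)
qed

end

theorem theorem3:
  fixes f :: "'a::euclidean_space \<Rightarrow> real"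
    and xs x0 :: 'a
    and L \<alpha> c \<eta> :: real
    and K N :: nat
  assumes "\<forall>x. f differentiable (at x)"
    and "unique_minimizer f xs"
    and "convex_on UNIV f"
    and "L > 0" and "L_smooth L f"
    and "\<alpha> > 0" and "quadratic_growth \<alpha> f xs"
    and "c > 0"
    and "0 < \<eta>" and "\<eta> \<le> 1 / sqrt L"
    and "K \<ge> 1"
    and "int N \<ge> \<lceil>c / (\<eta> * sqrt \<alpha>)\<rceil>"
  shows "f (dHFA_eg f 0 \<eta> (\<lambda>_. N) x0 K) - f xs
           \<le> (2 / 3 + 2 / (3 * c\<^sup>2)) ^ K * (f x0 - f xs)"
proof -
  have "L * \<eta>\<^sup>2 \<le> 1"
  proof -
    have "\<eta>\<^sup>2 \<le> (1 / sqrt L)\<^sup>2"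
      using assms by (intro power_mono) auto
    then show ?thesis
      using \<open>L > 0\<close> by (simp add: power_divide field_simps)
  qed
  moreover have "f xs \<le> f z" for z
    using assms(2) by (auto simp: unique_minimizer_def is_arg_min_linorder)
  ultimately interpret eg_method f L \<eta> xs
    using assms by unfold_locales auto
  have "c / (\<eta> * sqrt \<alpha>) \<le> real N"
    using assms(12) by linarith
  then have N: "c \<le> \<eta> * sqrt \<alpha> * real N"
    using assms by (simp add: field_simps)
  let ?\<rho> = "2 / 3 + 2 / (3 * c\<^sup>2)"
  show ?thesis
  proof (induction K)
    case 0
    then show ?case by simp
  next
    case (Suc K)
    let ?x = "dHFA_eg f 0 \<eta> (\<lambda>_. N) x0 K"
    have "f (x_avg f \<eta> ?x N) - f xs \<le> ?\<rho> * (f ?x - f xs)"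
      by (rule x_avg_contraction[OF \<open>\<alpha> > 0\<close> assms(7) \<open>c > 0\<close> N])
    also have "\<dots> \<le> ?\<rho> * (?\<rho> ^ K * (f x0 - f xs))"
      using Suc.IH by (intro mult_left_mono) auto
    finally show ?case
      by (simp add: mult.assoc)
  qed
qed

end
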